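(* Let $\alpha=(\alpha_1,\ldots,\alpha_r)$ and $\beta=(\beta_1,\ldots,\beta_s)$ be two (nonempty) dotted compositions. Then, in $\mathbf{sNSym}$, $$R_{\alpha}R_{\beta}=\begin{cases}R_{\alpha\beta}&\text{if both }\alpha_r\in\dot{\mathbb N}_0\text{ and }\beta_1\in\dot{\mathbb N}_0,\\ R_{\alpha\beta}+R_{\alpha\odot\beta}&\text{otherwise.}\end{cases}$$
   Context: Let $\mathbb N=\{1,2,\ldots\}$ and $\dot{\mathbb N}_0=\{\dot0,\dot1,\dot2,\ldots\}$ (dotted copies of the nonnegative integers). A dotted composition is a finite tuple $\alpha=(\alpha_1,\ldots,\alpha_k)$ with entries in $\mathbb N\cup\dot{\mathbb N}_0$; its length is $\ell(\alpha)=k$. For entries not both dotted put $m\oplus n=m+n$ and $m\oplus\dot n=\dot m\oplus n=\dot r$ with $r=m+n$. The partial order $\preceq$ on dotted compositions is the reflexive-transitive closure of the relation: $\beta$ is obtained from $\alpha$ by replacing two consecutive entries $x,y$ of $\alpha$ that are not both dotted by the single entry $x\oplus y$ (then $\alpha\preceq\beta$). $\mathbf{sNSym}$, as an algebra, is the free associative unital $\mathbb Q$-algebra on generators $H_n$ ($n\in\mathbb N$) and $H_{\dot n}=\tilde H_n$ ($n\ge0$); $H_\alpha:=H_{\alpha_1}\cdots H_{\alpha_k}$, and the $H_\alpha$ form a basis. The noncommutative Ribbon Schur functions in superspace $R_\alpha\in\mathbf{sNSym}$ are defined recursively by $R_\alpha=H_\alpha-\sum_{\alpha\prec\beta}R_\beta$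 (so $R_\alpha=H_\alpha$ if $\alpha$ is maximal for $\preceq$). $\alpha\beta$ is the concatenation of $\alpha$ and $\beta$. If $\alpha_r$ and $\beta_1$ are not both dotted, $\alpha\odot\beta:=(\alpha_1,\ldots,\alpha_{r-1},\alpha_r\oplus\beta_1,\beta_2,\ldots,\beta_s)$. *)

theory Defs
  imports Complex_Main "HOL-Library.Poly_Mapping"
begin

typedef pnat = "{n::nat. 1 \<le> n}"
  morphisms nat_of_pnat pnat_of_nat
  by auto

setup_lifting type_definition_pnat

instantiation pnat :: semigroup_add
begin

lift_definition plus_pnat :: "pnat \<Rightarrow> pnat \<Rightarrow> pnat" is "(+)"
  by simp

instance
  by standard (transfer, simp)

end

datatype entry = Undotted pnat | is_dotted: Dotted nat

type_synonym dotted_comp = "entry list"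

(* Two dotted entries have no sum; in that case the value is left unspecified. *)
fun oplus :: "entry \<Rightarrow> entry \<Rightarrow> entry" (infixl "\<oplus>" 65) where
  "Undotted m \<oplus> Undotted n = Undotted (m + n)"
| "Undotted m \<oplus> Dotted n = Dotted (nat_of_pnat m + n)"
| "Dotted m \<oplus> Undotted n = Dotted (m + nat_of_pnat n)"
| "Dotted m \<oplus> Dotted n = undefined"

inductive merge_step :: "dotted_comp \<Rightarrow> dotted_comp \<Rightarrow> bool" where
  "\<not> (is_dotted x \<and> is_dotted y) \<Longrightarrow> merge_step (us @ x # y # vs) (us @ (x \<oplus> y) # vs)"

definition comp_le :: "dotted_comp \<Rightarrow> dotted_comp \<Rightarrow> bool" (infix "\<preceq>" 50) where
  "\<alpha> \<preceq> \<beta> \<longleftrightarrow> merge_step\<^sup>*\<^sup>* \<alpha> \<beta>"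

definition comp_less :: "dotted_comp \<Rightarrow> dotted_comp \<Rightarrow> bool" (infix "\<prec>" 50) where
  "\<alpha> \<prec> \<beta> \<longleftrightarrow> \<alpha> \<preceq> \<beta> \<and> \<alpha> \<noteq> \<beta>"

(* Meaningful only for nonempty arguments whose touching entries are not both dotted. *)
definition near_concat :: "dotted_comp \<Rightarrow> dotted_comp \<Rightarrow> dotted_comp" (infixl "\<odot>" 65) where
  "\<alpha> \<odot> \<beta> = butlast \<alpha> @ (last \<alpha> \<oplus> hd \<beta>) # tl \<beta>"

lemma merge_step_length: "merge_step \<alpha> \<beta> \<Longrightarrow> length \<alpha> = Suc (length \<beta>)"
  by (induction rule: merge_step.induct) simp

lemma comp_le_length: "\<alpha> \<preceq> \<beta> \<Longrightarrow> \<alpha> = \<beta> \<or> length \<beta> < length \<alpha>"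
  unfolding comp_le_def
  by (induction rule: rtranclp_induct) (auto dest: merge_step_length)

lemma comp_less_length: "\<alpha> \<prec> \<beta> \<Longrightarrow> length \<beta> < length \<alpha>"
  using comp_le_length by (auto simp: comp_less_def)

lemma comp_le_antisym: "\<alpha> \<preceq> \<beta> \<Longrightarrow> \<beta> \<preceq> \<alpha> \<Longrightarrow> \<alpha> = \<beta>"
  by (auto dest!: comp_le_length)

lemma finite_merge_step: "finite {\<beta>. merge_step \<alpha> \<beta>}"
proof -
  have "{\<beta>. merge_step \<alpha> \<beta>}
      \<subseteq> (\<lambda>i. take i \<alpha> @ (\<alpha> ! i \<oplus> \<alpha> ! Suc i) # drop (i + 2) \<alpha>) ` {..<length \<alpha>}"
  proof
    fix \<beta> assume "\<beta> \<in> {\<beta>. merge_step \<alpha> \<beta>}"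
    then have "merge_step \<alpha> \<beta>" by simp
    then show "\<beta> \<in> (\<lambda>i. take i \<alpha> @ (\<alpha> ! i \<oplus> \<alpha> ! Suc i) # drop (i + 2) \<alpha>) ` {..<length \<alpha>}"
    proof cases
      case (1 x y us vs)
      then show ?thesis by (auto intro!: image_eqI[of _ _ "length us"] simp: nth_append)
    qed
  qed
  then show ?thesis by (rule finite_subset) simp
qed

lemma finite_comp_ge: "finite {\<beta>. \<alpha> \<preceq> \<beta>}"
proof (induction "length \<alpha>" arbitrary: \<alpha> rule: less_induct)
  case less
  have "{\<beta>. \<alpha> \<preceq> \<beta>} = insert \<alpha> (\<Union>\<gamma>\<in>{\<gamma>. merge_step \<alpha> \<gamma>}. {\<beta>. \<gamma> \<preceq> \<beta>})"
    unfolding comp_le_def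
    by (auto elim: converse_rtranclpE intro: converse_rtranclp_into_rtranclp)
  then show ?case
    using less finite_merge_step merge_step_length by simp
qed

(* Makes the sum in the recursion for R a genuine finite sum. *)
lemma finite_comp_greater: "finite {\<beta>. \<alpha> \<prec> \<beta>}"
  by (rule finite_subset[OF _ finite_comp_ge[of \<alpha>]]) (auto simp: comp_less_def)

(* Lists under concatenation are the free monoid; with this instance the convolution
   product on finitely supported functions is the multiplication of the monoid algebra. *)
instantiation list :: (type) monoid_add
begin

definition zero_list :: "'a list" where "zero_list = []"

definition plus_list :: "'a list \<Rightarrow> 'a list \<Rightarrow> 'a list" where "plus_list = (@)"

instance
  by standard (simp_all add: zero_list_def plus_list_def)

end

(* The free associative unital algebra over the rationals on a set of generators, realised as
   the monoid algebra of the free monoid: rational combinations of words in the generators. *)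
type_synonym sNSym = "entry list \<Rightarrow>\<^sub>0 rat"

definition H_gen :: "entry \<Rightarrow> sNSym" where
  "H_gen x = Poly_Mapping.single [x] 1"

definition H :: "dotted_comp \<Rightarrow> sNSym" where
  "H \<alpha> = prod_list (map H_gen \<alpha>)"

(* The products of generators are exactly the standard basis vectors. *)
lemma H_eq_single: "H \<alpha> = Poly_Mapping.single \<alpha> 1"
proof (induction \<alpha>)
  case Nil
  have "Poly_Mapping.single (0 :: entry list) 1 = (1 :: sNSym)"
    by (rule single_one)
  then show ?case by (simp add: H_def zero_list_def)
next
  case (Cons x \<alpha>)
  then show ?case by (simp add: H_def H_gen_def mult_single plus_list_def)
qed

function R :: "dotted_comp \<Rightarrow> sNSym" where
  "R \<alpha> = H \<alpha> - (\<Sum>\<beta> | \<alpha> \<prec> \<beta>. R \<beta>)"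
  by auto
termination
  by (relation "measure length") (auto dest: comp_less_length)

declare R.simps [simp del]

end

theory Submission imports Defs begin

text \<open>
  Unfolding the recursion gives \<open>H \<alpha> = (\<Sum>\<beta> | \<alpha> \<preceq> \<beta>. R \<beta>)\<close>, so everything rests on how the
  compositions above a word arise. It suffices to peel off a single letter: a composition
  above \<open>x # \<alpha>\<close>, with \<open>\<alpha>\<close> nonempty, is either \<open>x # \<delta>\<close> or \<open>[x] \<odot> \<delta>\<close> for a composition \<open>\<delta>\<close>
  above \<open>\<alpha>\<close>, according to whether \<open>x\<close> has stayed alone or has been merged into the block on
  its right. This description is unique: \<open>\<oplus>\<close> is left cancellative, and a merged first
  entry is never equal to \<open>x\<close>, because undotted entries are positive and a merge with a dotted
  entry adds a dot (lemma \<open>sum_R_above_Cons\<close>).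

  Comparing the expansion of \<open>H (x # \<alpha>)\<close> with that of \<open>H [x] * H \<alpha>\<close>, and cancelling the terms
  of all \<open>\<delta>\<close> strictly above \<open>\<alpha>\<close> by induction on the length, yields the case of a one-letter
  left factor (lemma \<open>H_single_times_R\<close>). Since \<open>R [x] = H [x]\<close>, that case is also a recursion
  for \<open>R\<close>,
  \<open>R (x # \<alpha>) = H [x] * R \<alpha> - R ([x] \<odot> \<alpha>)\<close>, where the last term is absent if both touching
  entries are dotted. The product rule in general then follows by induction on the left
  factor, multiplying this recursion by \<open>R \<beta>\<close> on the right and using associativity of \<open>\<odot>\<close>.
\<close>

section \<open>Merging entries\<close>

lemma is_dotted_oplus:
  "\<not> (is_dotted x \<and> is_dotted y) \<Longrightarrow> is_dotted (x \<oplus> y) \<longleftrightarrow> is_dotted x \<or> is_dotted y"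
  by (cases x; cases y) auto

text \<open>A sum of three entries makes sense iff at most one of them is dotted; in that case both
  bracketings are legal, which is why it is enough to assume legality of one of them.\<close>

lemma oplus_assoc:
  assumes "\<not> (is_dotted x \<and> is_dotted y)" and "\<not> (is_dotted (x \<oplus> y) \<and> is_dotted z)"
  shows "x \<oplus> y \<oplus> z = x \<oplus> (y \<oplus> z)"
  using assms
  by (cases x; cases y; cases z) (auto simp: add.assoc plus_pnat.rep_eq)

lemma nat_of_pnat_pos: "0 < nat_of_pnat n"
  using nat_of_pnat[of n] by simp

lemma oplus_neq_left:
  assumes "\<not> (is_dotted x \<and> is_dotted y)"
  shows "x \<oplus> y \<noteq> x"
proof -
  have "m + n \<noteq> m" for m n :: pnat
    using nat_of_pnat_pos[of n] by (metis plus_pnat.rep_eq add_cancel_left_right less_irrefl)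
  moreover have "nat_of_pnat n \<noteq> 0" for n
    using nat_of_pnat_pos[of n] by simp
  ultimately show ?thesis
    using assms by (cases x; cases y) auto
qed

lemma oplus_left_cancel:
  assumes "\<not> (is_dotted x \<and> is_dotted y)" "\<not> (is_dotted x \<and> is_dotted z)" "x \<oplus> y = x \<oplus> z"
  shows "y = z"
proof -
  have "n = n'" if "m + n = m + n'" for m n n' :: pnat
    using that by (metis plus_pnat.rep_eq add_left_cancel nat_of_pnat_inject)
  then show ?thesis
    using assms by (cases x; cases y; cases z) (auto simp: nat_of_pnat_inject)
qed

section \<open>The compositions above a given one\<close>

lemma merge_step_Cons_iff:
  "merge_step (x # \<alpha>) \<gamma> \<longleftrightarrow>
     (\<exists>y vs. \<alpha> = y # vs \<and> \<not> (is_dotted x \<and> is_dotted y) \<and> \<gamma> = (x \<oplus> y) # vs) \<or>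
     (\<exists>\<alpha>'. merge_step \<alpha> \<alpha>' \<and> \<gamma> = x # \<alpha>')"
  (is "?L \<longleftrightarrow> ?R")
proof
  assume ?L
  then show ?R
  proof cases
    case (1 a b us vs)
    then show ?thesis
      by (cases us) (auto intro: merge_step.intros)
  qed
next
  assume ?R
  then show ?L
  proof (elim disjE exE conjE)
    fix y vs assume "\<alpha> = y # vs" "\<not> (is_dotted x \<and> is_dotted y)" "\<gamma> = (x \<oplus> y) # vs"
    then show ?L using merge_step.intros[of x y "[]" vs] by simp
  next
    fix \<alpha>' assume "merge_step \<alpha> \<alpha>'" and g: "\<gamma> = x # \<alpha>'"
    then show ?L
    proof cases
      case (1 a b us vs)
      then show ?thesis using g merge_step.intros[of a b "x # us" vs] by simp
    qed
  qed
qed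

lemma comp_le_refl [simp]: "\<alpha> \<preceq> \<alpha>"
  by (simp add: comp_le_def)

lemma comp_le_step: "\<alpha> \<preceq> \<beta> \<Longrightarrow> merge_step \<beta> \<gamma> \<Longrightarrow> \<alpha> \<preceq> \<gamma>"
  by (simp add: comp_le_def)

lemma comp_le_nonempty:
  assumes "\<alpha> \<preceq> \<beta>" and "\<alpha> \<noteq> []"
  shows "\<beta> \<noteq> []"
  using assms unfolding comp_le_def
  by (induction rule: rtranclp_induct) (auto elim: merge_step.cases)

lemma comp_le_Cons:
  assumes "\<alpha> \<preceq> \<beta>"
  shows "x # \<alpha> \<preceq> x # \<beta>"
  using assms unfolding comp_le_def
  by (induction rule: rtranclp_induct) (auto simp: merge_step_Cons_iff intro: rtranclp.intros)

lemma near_concat_single: "[x] \<odot> (y # \<delta>) = (x \<oplus> y) # \<delta>"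
  by (simp add: near_concat_def)

text \<open>The right-hand side contains \<open>x # \<alpha>\<close> and is closed under merging: a merge that swallows
  the entry after the block of \<open>x\<close> can, by associativity, be performed inside \<open>\<delta>\<close> before \<open>x\<close>
  is attached.\<close>

lemma above_Cons:
  assumes "\<alpha> \<noteq> []"
  shows "{\<gamma>. x # \<alpha> \<preceq> \<gamma>} =
    (#) x ` {\<delta>. \<alpha> \<preceq> \<delta>} \<union>
    (\<odot>) [x] ` {\<delta>. \<alpha> \<preceq> \<delta> \<and> \<not> (is_dotted x \<and> is_dotted (hd \<delta>))}"
  (is "?L = ?A \<union> ?B")
proof
  show "?L \<subseteq> ?A \<union> ?B"
  proof
    fix \<gamma> assume "\<gamma> \<in> ?L"
    then have "merge_step\<^sup>*\<^sup>* (x # \<alpha>) \<gamma>" by (simp add: comp_le_def)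
    then show "\<gamma> \<in> ?A \<union> ?B"
    proof (induction rule: rtranclp_induct)
      case base
      show ?case by simp
    next
      case (step \<gamma> \<gamma>')
      from step.IH show ?case
      proof
        assume "\<gamma> \<in> ?A"
        then obtain \<delta> where d: "\<alpha> \<preceq> \<delta>" "\<gamma> = x # \<delta>" by blast
        from step.hyps(2) consider
            y vs where "\<delta> = y # vs" "\<not> (is_dotted x \<and> is_dotted y)" "\<gamma>' = (x \<oplus> y) # vs"
          | \<delta>' where "merge_step \<delta> \<delta>'" "\<gamma>' = x # \<delta>'"
          unfolding d merge_step_Cons_iff by blast
        then show ?thesis
        proof cases
          case 1
          then have "\<gamma>' = [x] \<odot> \<delta>" "\<not> (is_dotted x \<and> is_dotted (hd \<delta>))"
            by (simp_all add: near_concat_single)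
          with d show ?thesis by blast
        next
          case 2
          with d show ?thesis by (blast intro: comp_le_step)
        qed
      next
        assume "\<gamma> \<in> ?B"
        then obtain \<delta> where d: "\<alpha> \<preceq> \<delta>" "\<not> (is_dotted x \<and> is_dotted (hd \<delta>))" "\<gamma> = [x] \<odot> \<delta>"
          by blast
        obtain y \<zeta> where y: "\<delta> = y # \<zeta>"
          using comp_le_nonempty[OF d(1) assms] by (cases \<delta>) auto
        have ok: "\<not> (is_dotted x \<and> is_dotted y)" using d y by simp
        from step.hyps(2) consider
            z vs where "\<zeta> = z # vs" "\<not> (is_dotted (x \<oplus> y) \<and> is_dotted z)"
              "\<gamma>' = (x \<oplus> y \<oplus> z) # vs"
          | \<zeta>' where "merge_step \<zeta> \<zeta>'" "\<gamma>' = (x \<oplus> y) # \<zeta>'"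
          unfolding d(3) y near_concat_single merge_step_Cons_iff by blast
        then show ?thesis
        proof cases
          case 1
          let ?d = "(y \<oplus> z) # vs"
          from 1 ok have yz: "\<not> (is_dotted y \<and> is_dotted z)"
            and xyz: "\<not> (is_dotted x \<and> is_dotted (y \<oplus> z))"
            by (auto simp: is_dotted_oplus)
          have "\<alpha> \<preceq> ?d"
            using d(1) yz 1(1) unfolding y
            by (auto intro!: comp_le_step[OF d(1)] simp: y merge_step_Cons_iff)
          moreover have "\<gamma>' = [x] \<odot> ?d"
            using 1 ok by (simp add: near_concat_single oplus_assoc)
          ultimately show ?thesis using xyz by auto
        next
          case 2
          then have "\<alpha> \<preceq> y # \<zeta>'"
            by (auto intro!: comp_le_step[OF d(1)] simp: y merge_step_Cons_iff)
          moreover have "\<gamma>' = [x] \<odot> (y # \<zeta>')"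
            using 2 by (simp add: near_concat_single)
          ultimately show ?thesis using ok by auto
        qed
      qed
    qed
  qed
next
  have "x # \<alpha> \<preceq> [x] \<odot> \<delta>" if d: "\<alpha> \<preceq> \<delta>" "\<not> (is_dotted x \<and> is_dotted (hd \<delta>))" for \<delta>
  proof -
    obtain y \<zeta> where "\<delta> = y # \<zeta>"
      using comp_le_nonempty[OF d(1) assms] by (cases \<delta>) auto
    then show ?thesis
      using d
      by (auto intro!: comp_le_step[OF comp_le_Cons] simp: near_concat_single merge_step_Cons_iff)
  qed
  then show "?A \<union> ?B \<subseteq> ?L"
    using comp_le_Cons by blast
qed

section \<open>Expansion of the complete functions into ribbons\<close>

text \<open>The value 0 for a junction of two dotted entries absorbs the case distinction of the
  product rule, so that sums over all \<open>\<delta>\<close> above \<open>\<alpha>\<close> need no side condition.\<close>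

definition near_R :: "dotted_comp \<Rightarrow> dotted_comp \<Rightarrow> sNSym" where
  "near_R \<alpha> \<beta> = (if is_dotted (last \<alpha>) \<and> is_dotted (hd \<beta>) then 0 else R (\<alpha> \<odot> \<beta>))"

lemma above_eq_insert: "{\<beta>. \<alpha> \<preceq> \<beta>} = insert \<alpha> {\<beta>. \<alpha> \<prec> \<beta>}"
  by (auto simp: comp_less_def)

lemma sum_above: "(\<Sum>\<beta> | \<alpha> \<preceq> \<beta>. f \<beta>) = f \<alpha> + (\<Sum>\<beta> | \<alpha> \<prec> \<beta>. f \<beta>)"
  unfolding above_eq_insert
  by (subst sum.insert) (auto simp: finite_comp_greater comp_less_def)

lemma H_eq_sum_R: "H \<alpha> = (\<Sum>\<beta> | \<alpha> \<preceq> \<beta>. R \<beta>)"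
  unfolding sum_above by (subst R.simps[of \<alpha>]) simp

lemma H_Cons: "H (x # \<alpha>) = H [x] * H \<alpha>"
  by (simp add: H_def)

text \<open>The two families in \<open>above_Cons\<close> are disjoint and each is parametrised injectively by
  \<open>\<delta>\<close>, so that the sum splits without multiplicities.\<close>

lemma sum_R_above_Cons:
  assumes "\<alpha> \<noteq> []"
  shows "(\<Sum>\<gamma> | x # \<alpha> \<preceq> \<gamma>. R \<gamma>) = (\<Sum>\<delta> | \<alpha> \<preceq> \<delta>. R (x # \<delta>) + near_R [x] \<delta>)"
proof -
  let ?U = "{\<delta>. \<alpha> \<preceq> \<delta>}"
  let ?D = "{\<delta>. \<alpha> \<preceq> \<delta> \<and> \<not> (is_dotted x \<and> is_dotted (hd \<delta>))}"
  have Cons: "\<exists>y \<zeta>. \<delta> = y # \<zeta>" if "\<alpha> \<preceq> \<delta>" for \<delta>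
    using comp_le_nonempty[OF that assms] by (cases \<delta>) auto
  have fin: "finite ?U" "finite ?D"
    using finite_comp_ge[of \<alpha>] by (auto intro: finite_subset[OF _ finite_comp_ge[of \<alpha>]])
  have disj: "(#) x ` ?U \<inter> (\<odot>) [x] ` ?D = {}"
  proof -
    have "x # \<delta> \<noteq> [x] \<odot> \<delta>'" if "\<delta>' \<in> ?D" for \<delta> \<delta>'
      using that Cons[of \<delta>'] oplus_neq_left[of x "hd \<delta>'"]
      by (auto simp: near_concat_single)
    then show ?thesis by auto
  qed
  have inj: "inj_on ((\<odot>) [x]) ?D"
  proof (rule inj_onI)
    fix \<delta> \<delta>' assume d: "\<delta> \<in> ?D" "\<delta>' \<in> ?D" "[x] \<odot> \<delta> = [x] \<odot> \<delta>'"
    obtain y \<zeta> y' \<zeta>' where y: "\<delta> = y # \<zeta>" "\<delta>' = y' # \<zeta>'"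
      using d Cons[of \<delta>] Cons[of \<delta>'] by blast
    with d show "\<delta> = \<delta>'"
      using oplus_left_cancel[of x y y'] by (simp add: near_concat_single)
  qed
  have "(\<Sum>\<gamma> | x # \<alpha> \<preceq> \<gamma>. R \<gamma>) = (\<Sum>\<gamma>\<in>(#) x ` ?U. R \<gamma>) + (\<Sum>\<gamma>\<in>(\<odot>) [x] ` ?D. R \<gamma>)"
    unfolding above_Cons[OF assms] using fin disj by (intro sum.union_disjoint) auto
  also have "\<dots> = (\<Sum>\<delta>\<in>?U. R (x # \<delta>)) + (\<Sum>\<delta>\<in>?D. R ([x] \<odot> \<delta>))"
    by (simp only: sum.reindex[OF inj] sum.reindex[OF inj_on_Cons1] comp_def)
  also have "(\<Sum>\<delta>\<in>?D. R ([x] \<odot> \<delta>)) = (\<Sum>\<delta>\<in>?U. near_R [x] \<delta>)"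
    by (rule sum.mono_neutral_cong_left) (auto simp: fin near_R_def)
  finally show ?thesis by (simp add: sum.distrib)
qed

section \<open>The product rule\<close>

text \<open>Both sides, summed over all \<open>\<delta>\<close> with \<open>\<alpha> \<preceq> \<delta>\<close> in place of \<open>\<alpha>\<close>, give \<open>H (x # \<alpha>)\<close>. Every
  \<open>\<delta> \<noteq> \<alpha>\<close> in the sum is shorter than \<open>\<alpha>\<close>, so the induction hypothesis cancels those terms
  and leaves the identity for \<open>\<alpha>\<close> itself.\<close>

lemma H_single_times_R:
  assumes "\<alpha> \<noteq> []"
  shows "H [x] * R \<alpha> = R (x # \<alpha>) + near_R [x] \<alpha>"
  using assms
proof (induction "length \<alpha>" arbitrary: \<alpha> rule: less_induct)
  case less
  have IH: "H [x] * R \<delta> = R (x # \<delta>) + near_R [x] \<delta>" if "\<alpha> \<prec> \<delta>" for \<delta>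
    using that less comp_less_length comp_le_nonempty by (auto simp: comp_less_def)
  have "H [x] * R \<alpha> + (\<Sum>\<delta> | \<alpha> \<prec> \<delta>. H [x] * R \<delta>) = H [x] * H \<alpha>"
    by (simp add: H_eq_sum_R[of \<alpha>] sum_above distrib_left sum_distrib_left)
  also have "\<dots> = (\<Sum>\<delta> | \<alpha> \<preceq> \<delta>. R (x # \<delta>) + near_R [x] \<delta>)"
    by (simp only: H_Cons[symmetric] H_eq_sum_R[of "x # \<alpha>"] sum_R_above_Cons[OF less.prems])
  also have "\<dots> = R (x # \<alpha>) + near_R [x] \<alpha> + (\<Sum>\<delta> | \<alpha> \<prec> \<delta>. H [x] * R \<delta>)"
    by (simp add: sum_above IH)
  finally show ?case by simp
qed

lemma R_single: "R [x] = H [x]"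
proof -
  have "{\<beta>. [x] \<prec> \<beta>} = {}"
    using comp_less_length[of "[x]"] comp_le_nonempty[of "[x]"]
    by (fastforce simp: comp_less_def)
  then show ?thesis by (simp only: R.simps[of "[x]"] sum.empty diff_zero)
qed

text \<open>What remains to be matched in the induction on the left factor: the near-concatenations
  of \<open>x\<close>, \<open>\<alpha>\<close> and \<open>\<beta>\<close> at both junctions. If \<open>\<alpha>\<close> is a single entry, the two
  bracketings vanish simultaneously, namely when at least two of the three touching
  entries are dotted.\<close>

lemma near_R_assoc:
  assumes "\<alpha> \<noteq> []" and "\<beta> \<noteq> []"
  shows "(if is_dotted (last \<alpha>) \<and> is_dotted (hd \<beta>) then 0 else near_R [x] (\<alpha> \<odot> \<beta>)) =
    (if is_dotted x \<and> is_dotted (hd \<alpha>) then 0 else near_R ([x] \<odot> \<alpha>) \<beta>)"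
proof -
  obtain y \<zeta> where a: "\<alpha> = y # \<zeta>" using assms by (cases \<alpha>) auto
  obtain z \<xi> where b: "\<beta> = z # \<xi>" using assms by (cases \<beta>) auto
  show ?thesis
  proof (cases "\<zeta> = []")
    case True
    then show ?thesis
      by (auto simp: a b near_R_def near_concat_def is_dotted_oplus oplus_assoc)
  next
    case False
    then show ?thesis
      by (auto simp: a b near_R_def near_concat_def)
  qed
qed

text \<open>The induction is on the length, because the recursion for \<open>R (x # \<alpha>)\<close> uses both \<open>\<alpha>\<close> and
  \<open>[x] \<odot> \<alpha>\<close> as shorter left factors.\<close>

lemma R_times_R:
  assumes "\<alpha> \<noteq> []" and "\<beta> \<noteq> []"
  shows "R \<alpha> * R \<beta> = R (\<alpha> @ \<beta>) + near_R \<alpha> \<beta>"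
  using assms(1)
proof (induction "length \<alpha>" arbitrary: \<alpha> rule: less_induct)
  case less
  then obtain x \<alpha>' where a: "\<alpha> = x # \<alpha>'" by (cases \<alpha>) auto
  show ?case
  proof (cases "\<alpha>' = []")
    case True
    then show ?thesis using H_single_times_R[OF assms(2), of x] by (simp add: a R_single)
  next
    case False
    let ?xa = "is_dotted x \<and> is_dotted (hd \<alpha>')"
    let ?ab = "is_dotted (last \<alpha>') \<and> is_dotted (hd \<beta>)"
    have len: "length ([x] \<odot> \<alpha>') < length \<alpha>" "[x] \<odot> \<alpha>' \<noteq> []"
      using False by (auto simp: a near_concat_def)
    have app: "([x] \<odot> \<alpha>') @ \<beta> = [x] \<odot> (\<alpha>' @ \<beta>)"
      using False by (simp add: near_concat_def)
    have "R \<alpha> * R \<beta> = H [x] * (R \<alpha>' * R \<beta>) - near_R [x] \<alpha>' * R \<beta>"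
      using H_single_times_R[OF False, of x]
      by (simp add: a algebra_simps flip: mult.assoc)
    \<comment> \<open>Product of \<open>H [x]\<close> with the rule for the shorter factor \<open>\<alpha>'\<close>.\<close>
    moreover have "H [x] * (R \<alpha>' * R \<beta>) =
        R (\<alpha> @ \<beta>) + near_R [x] (\<alpha>' @ \<beta>) + H [x] * near_R \<alpha>' \<beta>"
      using less.hyps[of \<alpha>'] False H_single_times_R[of "\<alpha>' @ \<beta>" x]
      by (simp add: a distrib_left)
    moreover have "H [x] * near_R \<alpha>' \<beta> =
        near_R \<alpha> \<beta> + (if ?ab then 0 else near_R [x] (\<alpha>' \<odot> \<beta>))"
      using H_single_times_R[of "\<alpha>' \<odot> \<beta>" x] False
      by (simp add: near_R_def[of \<alpha>' \<beta>] near_R_def[of "x # \<alpha>'" \<beta>] a near_concat_def)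
    \<comment> \<open>The rule for the other shorter factor, \<open>[x] \<odot> \<alpha>'\<close>.\<close>
    moreover have "near_R [x] \<alpha>' * R \<beta> =
        near_R [x] (\<alpha>' @ \<beta>) + (if ?xa then 0 else near_R ([x] \<odot> \<alpha>') \<beta>)"
      using less.hyps[OF len] False app by (auto simp: near_R_def[of "[x]"])
    ultimately show ?thesis
      using near_R_assoc[OF False assms(2), of x] by simp
  qed
qed

theorem theorem6p1:
  fixes \<alpha> \<beta> :: dotted_comp
  assumes "\<alpha> \<noteq> []" and "\<beta> \<noteq> []"
  shows "R \<alpha> * R \<beta> =
    (if is_dotted (last \<alpha>) \<and> is_dotted (hd \<beta>)
     then R (\<alpha> @ \<beta>)
     else R (\<alpha> @ \<beta>) + R (\<alpha> \<odot> \<beta>))"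
  using R_times_R[OF assms] by (simp add: near_R_def)

end
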